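(* Let $a_n = E(\det(G_n))$, $p_n = E(\operatorname{perm}(G_n))$ and $t_n = \operatorname{trace}(M^n)$, where $G_n$ is the random Gram matrix of size $n$ and $M$ is the $t\times t$ matrix of second moments of the underlying random vector $w$. Then $a_0=1$, $p_0=1$, and for every integer $n\ge 0$, $$a_{n+1} = \sum_{j=0}^{n} \binom{n}{j} (-1)^j\, j!\, a_{n-j}\, t_{j+1}$$ and $$p_{n+1} = \sum_{j=0}^{n} \binom{n}{j}\, j!\, p_{n-j}\, t_{j+1}.$$
   Context: Let $t\ge 1$ be an integer and let $w=(w_1,\dots,w_t)^T$ be a random vector whose components are real random variables (not necessarily independent or identically distributed), with all second moments $E(w_iw_j)$ finite. The matrix of second moments is the $t\times t$ matrix $M$ with $M_{ij}=E(w_iw_j)$, $1\le i,j\le t$. For each $n\ge 0$, let $w^{(1)},\dots,w^{(n)}$ be $n$ independent random vectors, each with the same distribution as $w$; let $A$ be the $t\times n$ matrix with columns $w^{(1)},\dots,w^{(n)}$. The random Gram matrix of size $n$ is the $n\times n$ matrix $G_n=A^TA$, so that $(G_n)_{ij}=w^{(i)}\cdot w^{(j)}$. $E$ denotes expectation, and $\operatorname{perm}(B)=\sum_{\sigma\in S_n}\prod_{i=1}^n B_{i,\sigma(i)}$ is the permanent of an $n\times n$ matrix $B$. By convention the determinant and permanent of the $0\times 0$ matrix equal $1$. *)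

theory Defs
  imports "HOL-Probability.Probability" "Jordan_Normal_Form.Determinant"
begin

text \<open>
  Both HOL-Analysis and Jordan\_Normal\_Form provide a determinant; the size of the matrices
  here is a natural number that varies, so matrices and determinants are those of
  Jordan\_Normal\_Form (indices start at 0), written \<open>Determinant.det\<close>.
\<close>

definition perm :: "'a :: comm_semiring_1 mat \<Rightarrow> 'a" where
  "perm B = (\<Sum>p | p permutes {0..<dim_row B}. \<Prod>i = 0..<dim_row B. B $$ (i, p i))"

definition mat_trace :: "'a :: comm_monoid_add mat \<Rightarrow> 'a" where
  "mat_trace B = (\<Sum>i = 0..<dim_row B. B $$ (i, i))"

text \<open>
  \<open>\<real>\<^sup>t\<close> with its Borel sets, as a product space: its points are the functions on \<open>{..<t}\<close>,
  extended by \<^const>\<open>undefined\<close> outside that set.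
\<close>

abbreviation real_space :: "nat \<Rightarrow> (nat \<Rightarrow> real) measure" where
  "real_space t \<equiv> Pi\<^sub>M {..<t} (\<lambda>_. borel)"

definition moment_matrix :: "nat \<Rightarrow> 'b measure \<Rightarrow> ('b \<Rightarrow> nat \<Rightarrow> real) \<Rightarrow> real mat" where
  "moment_matrix t P w = mat t t (\<lambda>(i, j). \<integral>x. w x i * w x j \<partial>P)"

text \<open>\<open>v j\<close> is the \<open>j\<close>-th column of \<open>A\<close>, a vector with coordinates \<open>v j k\<close> for \<open>k < t\<close>.\<close>

definition gram_matrix :: "nat \<Rightarrow> nat \<Rightarrow> (nat \<Rightarrow> nat \<Rightarrow> real) \<Rightarrow> real mat" where
  "gram_matrix t n v = (let A = mat t n (\<lambda>(k, j). v j k) in A\<^sup>T * A)"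

text \<open>
  The columns \<open>W 0, \<dots>, W (n - 1)\<close>, defined on a probability space \<open>Q\<close>, are independent copies
  of the random vector \<open>w\<close>, defined on a possibly different probability space \<open>P\<close>.
\<close>

definition indep_copies ::
  "nat \<Rightarrow> 'b measure \<Rightarrow> ('b \<Rightarrow> nat \<Rightarrow> real) \<Rightarrow> nat \<Rightarrow> 'c measure \<Rightarrow> (nat \<Rightarrow> 'c \<Rightarrow> nat \<Rightarrow> real) \<Rightarrow> bool"
where
  "indep_copies t P w n Q W \<longleftrightarrow>
     prob_space.indep_vars Q (\<lambda>_. real_space t) W {..<n} \<and>
     (\<forall>i<n. distr Q (real_space t) (W i) = distr P (real_space t) w)"

end

theory Submission
  imports Defs
begin

text \<open>
  Why the recursions hold. Expand the permanent or determinant of \<open>G\<close> over permutations \<open>\<sigma>\<close>,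
  and each entry \<open>w\<^sub>i \<bullet> w\<^sub>j\<close> over coordinates. In every resulting monomial the vector
  \<open>w\<^sub>i\<close> occurs exactly twice, once for the edge of \<open>\<sigma>\<close> that leaves \<open>i\<close> and once for the edge
  that enters \<open>i\<close>. Independence therefore factors the expectation into second moments, one entry of
  \<open>M\<close> for each \<open>i\<close>, and \<open>a\<^sub>n\<close>, \<open>p\<^sub>n\<close> become purely algebraic sums
  \<open>\<Sum>\<^sub>\<sigma> \<theta>(\<sigma>) \<Sum>\<^sub>f \<Prod>\<^sub>i M(f i, f (\<sigma> i))\<close>, with \<open>\<theta>\<close> the sign or the constant 1
  (\<open>expectation_gram_permutation_sum\<close>). Summing over \<open>f\<close>, a cycle of length \<open>l\<close> contributes
  \<open>trace (M\<^sup>l)\<close>; the recursion classifies the permutations of \<open>n + 1\<close>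
  points by the cycle through a chosen point: there are \<open>(n choose j) j!\<close> cycles of length \<open>j + 1\<close>
  through it, each of sign \<open>(-1)\<^sup>j\<close>.

  Cycle decompositions never appear in the formal argument; instead the cycle through a point is
  contracted one step at a time. Each point \<open>i\<close> carries its own matrix \<open>B i\<close>. Deleting a point \<open>x\<close>
  from its cycle and summing over its label \<open>f x\<close> multiplies the matrix of the predecessor of \<open>x\<close> by
  \<open>B x\<close>, or splits off the factor \<open>trace (B x)\<close> if \<open>x\<close> is a fixed point
  (\<open>labelled_perm_sum_insert\<close>). Starting from \<open>B i = M\<close> for all \<open>i\<close>, there is always just one
  exceptional point, whose matrix accumulates a power of \<open>M\<close>; repeating the step until the cycle
  closes gives \<open>labelled_perm_sum_marked\<close>. Each of the \<open>j\<close> contractions has as many choices for the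
  predecessor as there are points left, whence the factor \<open>n (n - 1) \<cdots> (n - j + 1) =
  (n choose j) j!\<close>, and contributes one factor \<open>c = \<plusminus>1\<close>.
\<close>

section \<open>Labelled permutation sums\<close>

text \<open>
  The matrices \<open>B i\<close> vary with \<open>i\<close> so that contracting a point of a permutation leads to a sum of
  the same kind.
\<close>
definition labelled_perm_sum ::
  "nat \<Rightarrow> (('i \<Rightarrow> 'i) \<Rightarrow> 'a) \<Rightarrow> ('i \<Rightarrow> 'a::comm_ring_1 mat) \<Rightarrow> 'i set \<Rightarrow> 'a" where
  "labelled_perm_sum t \<theta> B S =
     (\<Sum>\<sigma> | \<sigma> permutes S. \<theta> \<sigma> * (\<Sum>f\<in>S \<rightarrow>\<^sub>E {..<t}. \<Prod>i\<in>S. B i $$ (f i, f (\<sigma> i))))"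

text \<open>
  The case \<open>c = 1\<close> serves the permanent and \<open>c = -1\<close> the determinant. Contracting a point changes a
  permutation by a transposition, so \<open>c\<close> is all that distinguishes the two recursions.
\<close>
definition transposition_multiplier :: "(('i \<Rightarrow> 'i) \<Rightarrow> 'a::comm_ring_1) \<Rightarrow> 'a \<Rightarrow> bool" where
  "transposition_multiplier \<theta> c \<longleftrightarrow>
     (\<forall>\<sigma> x y. permutation \<sigma> \<longrightarrow> x \<noteq> y \<longrightarrow> \<theta> (\<sigma> \<circ> Transposition.transpose x y) = c * \<theta> \<sigma>)"

lemma transposition_multiplier_trivial: "transposition_multiplier (\<lambda>_. 1) 1"
  by (simp add: transposition_multiplier_def)

lemma transposition_multiplier_sign: "transposition_multiplier (\<lambda>\<sigma>. of_int (sign \<sigma>)) (-1)"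
  by (simp add: transposition_multiplier_def sign_compose permutation_swap_id sign_swap_id)

lemma labelled_perm_sum_cong:
  assumes "\<And>i. i \<in> S \<Longrightarrow> B i = C i"
  shows "labelled_perm_sum t \<theta> B S = labelled_perm_sum t \<theta> C S"
  unfolding labelled_perm_sum_def using assms
  by (intro sum.cong prod.cong arg_cong2[where f = "(*)"] refl) auto

lemma sum_PiE_insert:
  assumes "x \<notin> S"
  shows "(\<Sum>f\<in>insert x S \<rightarrow>\<^sub>E T. g f) = (\<Sum>f\<in>S \<rightarrow>\<^sub>E T. \<Sum>k\<in>T. g (f(x := k)))"
proof -
  have "(\<Sum>f\<in>insert x S \<rightarrow>\<^sub>E T. g f) = (\<Sum>(k, f)\<in>T \<times> (S \<rightarrow>\<^sub>E T). g (f(x := k)))"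
    unfolding PiE_insert_eq
    by (subst sum.reindex[OF inj_combinator[OF assms]]) (simp add: case_prod_unfold)
  also have "\<dots> = (\<Sum>k\<in>T. \<Sum>f\<in>S \<rightarrow>\<^sub>E T. g (f(x := k)))"
    by (simp add: sum.cartesian_product)
  finally show ?thesis by (simp add: sum.swap[of _ T])
qed

text \<open>
  In the second summand, \<open>\<tau> \<circ> transpose x y\<close> is \<open>\<tau>\<close> with \<open>x\<close> inserted into its cycle
  directly after \<open>y\<close>; so \<open>y\<close> is the predecessor of \<open>x\<close>. Composing with
  the transposition on the left, as in \<open>sum_over_permutations_insert\<close>, prescribes the successor of \<open>x\<close>
  instead; inverting all permutations exchanges the two.
\<close>
lemma sum_over_permutations_insert_right:
  assumes "finite S" "x \<notin> S"
  shows "(\<Sum>\<sigma> | \<sigma> permutes insert x S. g \<sigma>) =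
    (\<Sum>\<tau> | \<tau> permutes S. g \<tau>) + (\<Sum>y\<in>S. \<Sum>\<tau> | \<tau> permutes S. g (\<tau> \<circ> Transposition.transpose x y))"
proof -
  have "(\<Sum>\<sigma> | \<sigma> permutes insert x S. g \<sigma>) = (\<Sum>\<sigma> | \<sigma> permutes insert x S. g (Hilbert_Choice.inv \<sigma>))"
    by (rule sum_permutations_inverse)
  also have "\<dots> = (\<Sum>y\<in>insert x S. \<Sum>\<tau> | \<tau> permutes S. g (Hilbert_Choice.inv (Transposition.transpose x y \<circ> \<tau>)))"
    by (rule sum_over_permutations_insert[OF assms])
  also have "\<dots> = (\<Sum>y\<in>insert x S. \<Sum>\<tau> | \<tau> permutes S. g (Hilbert_Choice.inv \<tau> \<circ> Transposition.transpose x y))"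
    by (intro sum.cong refl arg_cong[where f = g])
       (simp add: o_inv_distrib permutes_bij)
  also have "\<dots> = (\<Sum>y\<in>insert x S. \<Sum>\<tau> | \<tau> permutes S. g (\<tau> \<circ> Transposition.transpose x y))"
    by (rule sum.cong[OF refl], rule sum_permutations_inverse[symmetric])
  finally show ?thesis
    using assms by simp
qed

section \<open>Contraction of a point\<close>

text \<open>
  If \<open>x\<close> is a fixed point of \<open>\<sigma>\<close>, its factor is \<open>B x (f x, f x)\<close> and the sum over \<open>f x\<close> gives the
  trace. Otherwise \<open>\<sigma>\<close> runs \<open>y \<mapsto> x \<mapsto> \<tau> y\<close> for some \<open>y\<close>, and the sum over \<open>f x\<close> of
  \<open>B y (f y, f x) * B x (f x, f (\<tau> y))\<close> is the entry \<open>(f y, f (\<tau> y))\<close> of \<open>B y * B x\<close>.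
\<close>
lemma labelled_perm_sum_insert:
  fixes B :: "'i \<Rightarrow> 'a::comm_ring_1 mat"
  assumes S: "finite S" "x \<notin> S"
    and B: "\<And>i. i \<in> insert x S \<Longrightarrow> B i \<in> carrier_mat t t"
    and \<theta>: "transposition_multiplier \<theta> c"
  shows "labelled_perm_sum t \<theta> B (insert x S) =
    mat_trace (B x) * labelled_perm_sum t \<theta> B S +
    c * (\<Sum>y\<in>S. labelled_perm_sum t \<theta> (B(y := B y * B x)) S)"
proof -
  let ?T = "{..<t}"
  define g where "g \<sigma> = \<theta> \<sigma> * (\<Sum>f\<in>insert x S \<rightarrow>\<^sub>E ?T. \<Prod>i\<in>insert x S. B i $$ (f i, f (\<sigma> i)))" for \<sigma>
  have fixed: "g \<tau> = mat_trace (B x) * (\<theta> \<tau> * (\<Sum>f\<in>S \<rightarrow>\<^sub>E ?T. \<Prod>i\<in>S. B i $$ (f i, f (\<tau> i))))"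
    if \<tau>: "\<tau> permutes S" for \<tau>
  proof -
    have "(\<Prod>i\<in>insert x S. B i $$ ((f(x := k)) i, (f(x := k)) (\<tau> i))) =
        B x $$ (k, k) * (\<Prod>i\<in>S. B i $$ (f i, f (\<tau> i)))" for f k
    proof -
      have "\<tau> x = x" using \<tau> S by (simp add: permutes_not_in)
      moreover have "i \<noteq> x" "\<tau> i \<noteq> x" if "i \<in> S" for i
        using that S permutes_in_image[OF \<tau>, of i] by auto
      ultimately show ?thesis using S by simp
    qed
    moreover have "mat_trace (B x) = (\<Sum>k\<in>?T. B x $$ (k, k))"
      using B[of x] by (simp add: mat_trace_def atLeast0LessThan)
    ultimately show ?thesis
      unfolding g_def by (simp add: sum_PiE_insert[OF S(2)] sum_distrib_left sum_distrib_right mult_ac)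
  qed
  have spliced: "g (\<tau> \<circ> Transposition.transpose x y) =
      c * (\<theta> \<tau> * (\<Sum>f\<in>S \<rightarrow>\<^sub>E ?T. \<Prod>i\<in>S. (B(y := B y * B x)) i $$ (f i, f (\<tau> i))))"
    if \<tau>: "\<tau> permutes S" and y: "y \<in> S" for \<tau> y
  proof -
    let ?\<sigma> = "\<tau> \<circ> Transposition.transpose x y"
    have xy: "x \<noteq> y" using y S by auto
    have "\<tau> x = x" using \<tau> S by (simp add: permutes_not_in)
    then have \<sigma>: "?\<sigma> x = \<tau> y" "?\<sigma> y = x" by simp_all
    have \<tau>S: "\<tau> i \<in> S" if "i \<in> S" for i
      using that permutes_in_image[OF \<tau>, of i] by simp
    have "(\<Sum>k\<in>?T. \<Prod>i\<in>insert x S. B i $$ ((f(x := k)) i, (f(x := k)) (?\<sigma> i))) =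
        (\<Prod>i\<in>S. (B(y := B y * B x)) i $$ (f i, f (\<tau> i)))" if f: "f \<in> S \<rightarrow>\<^sub>E ?T" for f
    proof -
      \<comment> \<open>away from \<open>y\<close>, neither the point nor its image meets \<open>x\<close>\<close>
      have rest: "(\<Prod>i\<in>S - {y}. B i $$ ((f(x := k)) i, (f(x := k)) (?\<sigma> i))) =
          (\<Prod>i\<in>S - {y}. B i $$ (f i, f (\<tau> i)))" for k
      proof (rule prod.cong[OF refl])
        fix i assume "i \<in> S - {y}"
        then have "i \<noteq> x" "i \<noteq> y" "\<tau> i \<noteq> x" using S \<tau>S[of i] by auto
        then show "B i $$ ((f(x := k)) i, (f(x := k)) (?\<sigma> i)) = B i $$ (f i, f (\<tau> i))"
          by (simp add: transpose_apply_other)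
      qed
      have "f y < t" "f (\<tau> y) < t" using f y \<tau>S[OF y] by auto
      then have contract: "(\<Sum>k\<in>?T. B y $$ (f y, k) * B x $$ (k, f (\<tau> y))) = (B y * B x) $$ (f y, f (\<tau> y))"
        using B[of x] B[of y] y by (simp add: scalar_prod_def atLeast0LessThan)
      have "(\<Sum>k\<in>?T. \<Prod>i\<in>insert x S. B i $$ ((f(x := k)) i, (f(x := k)) (?\<sigma> i))) =
          (\<Sum>k\<in>?T. B x $$ (k, f (\<tau> y)) * (B y $$ (f y, k) * (\<Prod>i\<in>S - {y}. B i $$ (f i, f (\<tau> i)))))"
      proof (rule sum.cong[OF refl])
        fix k
        have "\<tau> y \<noteq> x" using \<tau>S[OF y] S by auto
        then show "(\<Prod>i\<in>insert x S. B i $$ ((f(x := k)) i, (f(x := k)) (?\<sigma> i))) =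
          B x $$ (k, f (\<tau> y)) * (B y $$ (f y, k) * (\<Prod>i\<in>S - {y}. B i $$ (f i, f (\<tau> i))))"
          unfolding prod.insert[OF S] prod.remove[OF S(1) y] rest \<sigma> using xy by simp
      qed
      also have "\<dots> = (B y * B x) $$ (f y, f (\<tau> y)) * (\<Prod>i\<in>S - {y}. B i $$ (f i, f (\<tau> i)))"
        unfolding contract[symmetric] by (simp add: sum_distrib_left sum_distrib_right mult_ac)
      also have "\<dots> = (\<Prod>i\<in>S. (B(y := B y * B x)) i $$ (f i, f (\<tau> i)))"
        unfolding prod.remove[OF S(1) y] by simp
      finally show ?thesis .
    qed
    moreover have "\<theta> ?\<sigma> = c * \<theta> \<tau>"
      using \<theta> xy \<tau> S(1) unfolding transposition_multiplier_def by (auto simp: permutation_permutes)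
    ultimately show ?thesis
      unfolding g_def by (simp add: sum_PiE_insert[OF S(2)] mult_ac)
  qed
  have "labelled_perm_sum t \<theta> B (insert x S) = (\<Sum>\<sigma> | \<sigma> permutes insert x S. g \<sigma>)"
    by (simp add: labelled_perm_sum_def g_def)
  also have "\<dots> = (\<Sum>\<tau> | \<tau> permutes S. g \<tau>) + (\<Sum>y\<in>S. \<Sum>\<tau> | \<tau> permutes S. g (\<tau> \<circ> Transposition.transpose x y))"
    by (rule sum_over_permutations_insert_right[OF S])
  also have "\<dots> = mat_trace (B x) * labelled_perm_sum t \<theta> B S +
    c * (\<Sum>y\<in>S. labelled_perm_sum t \<theta> (B(y := B y * B x)) S)"
    by (simp add: fixed spliced labelled_perm_sum_def sum_distrib_left del: fun_upd_apply)
  finally show ?thesis .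
qed

text \<open>
  One point \<open>x\<close> carries a matrix \<open>N\<close> that stands for an already contracted part of its cycle. Contracting
  \<open>x\<close> into its predecessor \<open>y\<close> makes \<open>y\<close> the exceptional point, with matrix \<open>M * N\<close>, so induction
  on the number of points applies for arbitrary \<open>N\<close>. The summand \<open>j\<close> collects the permutations whose
  cycle through \<open>x\<close> has \<open>j\<close> further points. The function \<open>F\<close> is a hypothesis since the independence of
  the sum over \<open>R\<close> from everything but \<open>card R\<close> is itself derived from this lemma, by induction.
\<close>
lemma labelled_perm_sum_marked:
  fixes M N :: "'a::comm_ring_1 mat"
  assumes M: "M \<in> carrier_mat t t" and N: "N \<in> carrier_mat t t"
    and \<theta>: "transposition_multiplier \<theta> c"
    and S: "finite S" "x \<notin> S"
    and F: "\<And>R. R \<subseteq> S \<Longrightarrow> labelled_perm_sum t \<theta> (\<lambda>_. M) R = F (card R)"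
  shows "labelled_perm_sum t \<theta> ((\<lambda>_. M)(x := N)) (insert x S) =
    (\<Sum>j = 0..card S. of_nat (card S choose j) * c ^ j * of_nat (fact j) * F (card S - j) *
       mat_trace (M ^\<^sub>m j * N))"
  using N S F
proof (induction "card S" arbitrary: S x N)
  case 0
  then have "S = {}" by simp
  have "labelled_perm_sum t \<theta> ((\<lambda>_. M)(x := N)) {x} =
      mat_trace N * labelled_perm_sum t \<theta> ((\<lambda>_. M)(x := N)) {}"
    using labelled_perm_sum_insert[of "{}" x "(\<lambda>_. M)(x := N)" t \<theta> c] 0 \<theta> by simp
  also have "labelled_perm_sum t \<theta> ((\<lambda>_. M)(x := N)) {} = F 0"
    using 0(5)[of "{}"] labelled_perm_sum_cong[of "{}"] by (metis card.empty empty_iff empty_subsetI)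
  finally show ?case
    using \<open>S = {}\<close> M 0 by (simp add: mult.commute)
next
  case (Suc n)
  let ?B = "(\<lambda>_. M)(x := N)"
  \<comment> \<open>with the cycle of \<open>x\<close> closed, only \<open>M\<close> is left; this gives the summand \<open>j = 0\<close>\<close>
  have off: "labelled_perm_sum t \<theta> ?B S = F (Suc n)"
  proof -
    have "labelled_perm_sum t \<theta> ?B S = labelled_perm_sum t \<theta> (\<lambda>_. M) S"
      using Suc.prems(3) by (intro labelled_perm_sum_cong) auto
    then show ?thesis using Suc.prems(4)[of S] Suc.hyps(2) by simp
  qed
  \<comment> \<open>after contraction the exceptional point is \<open>y\<close>, and \<open>x\<close> is gone\<close>
  have marked: "labelled_perm_sum t \<theta> (?B(y := ?B y * ?B x)) S =
     (\<Sum>j = 0..n. of_nat (n choose j) * c ^ j * of_nat (fact j) * F (n - j) * mat_trace (M ^\<^sub>m Suc j * N))"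
    if y: "y \<in> S" for y
  proof -
    have yx: "y \<noteq> x" using y Suc.prems by auto
    have card: "n = card (S - {y})" using Suc.hyps(2) y by simp
    have "labelled_perm_sum t \<theta> (?B(y := ?B y * ?B x)) S =
        labelled_perm_sum t \<theta> ((\<lambda>_. M)(y := M * N)) (insert y (S - {y}))"
      using Suc.prems(3) yx by (subst insert_Diff[OF y], intro labelled_perm_sum_cong) auto
    also have "\<dots> = (\<Sum>j = 0..n. of_nat (n choose j) * c ^ j * of_nat (fact j) * F (n - j) *
        mat_trace (M ^\<^sub>m j * (M * N)))"
      unfolding card using Suc.prems M by (intro Suc.hyps(1)[OF card]) auto
    finally show ?thesis
      using M Suc.prems(1) by (simp add: assoc_mult_mat[of _ t t _ t _ t])
  qed
  have at_x: "mat_trace (?B x) = mat_trace N" by simp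
  have "labelled_perm_sum t \<theta> ?B (insert x S) =
      mat_trace (?B x) * labelled_perm_sum t \<theta> ?B S +
      c * (\<Sum>y\<in>S. labelled_perm_sum t \<theta> (?B(y := ?B y * ?B x)) S)"
    using M Suc.prems \<theta> by (intro labelled_perm_sum_insert) auto
  also have "\<dots> = mat_trace N * F (Suc n) + c * (of_nat (Suc n) *
      (\<Sum>j = 0..n. of_nat (n choose j) * c ^ j * of_nat (fact j) * F (n - j) * mat_trace (M ^\<^sub>m Suc j * N)))"
    unfolding off by (simp add: marked at_x Suc.hyps(2) del: fun_upd_apply pow_mat.simps)
  \<comment> \<open>The factor \<open>Suc n\<close> counts the predecessors \<open>y\<close>; it turns the coefficient for \<open>n, j\<close> into the one
    for \<open>Suc n, Suc j\<close>.\<close>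
  also have "c * (of_nat (Suc n) *
      (\<Sum>j = 0..n. of_nat (n choose j) * c ^ j * of_nat (fact j) * F (n - j) * mat_trace (M ^\<^sub>m Suc j * N))) =
      (\<Sum>j = 0..n. of_nat (Suc n choose Suc j) * c ^ Suc j * of_nat (fact (Suc j)) * F (Suc n - Suc j) *
        mat_trace (M ^\<^sub>m Suc j * N))"
    unfolding sum_distrib_left
  proof (intro sum.cong refl)
    fix j
    have "(Suc n choose Suc j) * fact (Suc j) = Suc n * (n choose j) * fact j"
      by (simp only: fact_Suc Suc_times_binomial_eq mult.assoc[symmetric] of_nat_id)
    then have "(of_nat (Suc n choose Suc j) * of_nat (fact (Suc j)) :: 'a) =
        of_nat (Suc n) * of_nat (n choose j) * of_nat (fact j)"
      by (simp only: of_nat_mult[symmetric])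
    then show "c * (of_nat (Suc n) *
        (of_nat (n choose j) * c ^ j * of_nat (fact j) * F (n - j) * mat_trace (M ^\<^sub>m Suc j * N))) =
        of_nat (Suc n choose Suc j) * c ^ Suc j * of_nat (fact (Suc j)) * F (Suc n - Suc j) *
        mat_trace (M ^\<^sub>m Suc j * N)"
      by (simp only: diff_Suc_Suc power_Suc mult_ac)
  qed
  also have "mat_trace N * F (Suc n) + \<dots> =
      (\<Sum>j = 0..Suc n. of_nat (Suc n choose j) * c ^ j * of_nat (fact j) * F (Suc n - j) * mat_trace (M ^\<^sub>m j * N))"
    unfolding sum.atLeast0_atMost_Suc_shift
    using M Suc.prems(1) by (simp add: mult.commute)
  finally show ?case unfolding Suc.hyps(2) .
qed

section \<open>The recursion\<close>

text \<open>
  By induction on the cardinality: the expansion around any point of \<open>S\<close> expresses the sum by values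
  on smaller sets, so it agrees with the expansion on \<open>{..<card S}\<close> around its largest element.
\<close>
lemma labelled_perm_sum_const_card:
  fixes M :: "'a::comm_ring_1 mat" and S :: "nat set"
  assumes M: "M \<in> carrier_mat t t" and \<theta>: "transposition_multiplier \<theta> c" and "finite S"
  shows "labelled_perm_sum t \<theta> (\<lambda>_. M) S = labelled_perm_sum t \<theta> (\<lambda>_. M) {..<card S}"
  using \<open>finite S\<close>
proof (induction "card S" arbitrary: S rule: less_induct)
  case less
  let ?F = "\<lambda>n. labelled_perm_sum t \<theta> (\<lambda>_. M) {..<n}"
  show ?case
  proof (cases "S = {}")
    case False
    then obtain x where x: "x \<in> S" by blast
    define n where "n = card (S - {x})"
    have n: "card S = Suc n" using card_Suc_Diff1[OF less.prems x] unfolding n_def by simp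
    have expand: "labelled_perm_sum t \<theta> (\<lambda>_. M) (insert y R) =
      (\<Sum>j = 0..n. of_nat (n choose j) * c ^ j * of_nat (fact j) * ?F (n - j) * mat_trace (M ^\<^sub>m j * M))"
      if R: "finite R" "y \<notin> R" "card R = n" for y R
    proof -
      have "labelled_perm_sum t \<theta> (\<lambda>_. M) R' = ?F (card R')" if "R' \<subseteq> R" for R'
        using card_mono[OF R(1) that] n R finite_subset[OF that R(1)] by (intro less.hyps) auto
      from labelled_perm_sum_marked[OF M M \<theta> R(1,2) this] show ?thesis
        by (simp add: R(3) fun_upd_idem)
    qed
    have "labelled_perm_sum t \<theta> (\<lambda>_. M) (insert x (S - {x})) =
        labelled_perm_sum t \<theta> (\<lambda>_. M) (insert n {..<n})"
      using less.prems n_def expand[of "S - {x}" x] expand[of "{..<n}" n] by simp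
    then show ?thesis
      using x by (simp add: n insert_absorb lessThan_Suc)
  qed simp
qed

lemma labelled_perm_sum_recursion:
  fixes M :: "'a::comm_ring_1 mat" and \<theta> :: "(nat \<Rightarrow> nat) \<Rightarrow> 'a"
  assumes M: "M \<in> carrier_mat t t" and \<theta>: "transposition_multiplier \<theta> c"
  shows "labelled_perm_sum t \<theta> (\<lambda>_. M) {..<Suc n} =
    (\<Sum>j = 0..n. of_nat (n choose j) * c ^ j * of_nat (fact j) *
       labelled_perm_sum t \<theta> (\<lambda>_. M) {..<n - j} * mat_trace (M ^\<^sub>m Suc j))"
proof -
  have "labelled_perm_sum t \<theta> (\<lambda>_. M) R = labelled_perm_sum t \<theta> (\<lambda>_. M) {..<card R}"
    if "R \<subseteq> {..<n}" for R
    using finite_subset[OF that] by (intro labelled_perm_sum_const_card[OF M \<theta>]) simp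
  from labelled_perm_sum_marked[OF M M \<theta> _ _ this, where x = n] show ?thesis
    by (simp add: fun_upd_idem lessThan_Suc)
qed

section \<open>Expectations over random Gram matrices\<close>

text \<open>
  The coordinate summed over in the entry for the edge \<open>i \<mapsto> \<sigma> i\<close> is called \<open>f (\<sigma> i)\<close>, that is, it is
  indexed by the end of the edge. Then both factors that belong to the vector \<open>v i\<close> stand together on
  the right-hand side: this is the form in which the factors are independent for independent columns.
\<close>
lemma gram_matrix_permutation_product:
  assumes \<sigma>: "\<sigma> permutes {..<n}"
  shows "(\<Prod>i<n. gram_matrix t n v $$ (i, \<sigma> i)) =
    (\<Sum>f\<in>{..<n} \<rightarrow>\<^sub>E {..<t}. \<Prod>i<n. v i (f i) * v i (f (\<sigma> i)))"
proof -
  have entry: "gram_matrix t n v $$ (i, j) = (\<Sum>k<t. v i k * v j k)" if "i < n" "j < n" for i j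
    using that by (simp add: gram_matrix_def Let_def scalar_prod_def atLeast0LessThan)
  have inv: "Hilbert_Choice.inv \<sigma> permutes {..<n}" using \<sigma> by (rule permutes_inv)
  have "(\<Prod>i<n. gram_matrix t n v $$ (i, \<sigma> i)) = (\<Prod>i<n. gram_matrix t n v $$ (Hilbert_Choice.inv \<sigma> i, \<sigma> (Hilbert_Choice.inv \<sigma> i)))"
    using prod.permute[OF inv, of "\<lambda>i. gram_matrix t n v $$ (i, \<sigma> i)"] by (simp add: o_def)
  also have "\<dots> = (\<Prod>i<n. \<Sum>k<t. v (Hilbert_Choice.inv \<sigma> i) k * v i k)"
    using permutes_in_image[OF inv] by (intro prod.cong) (auto simp: permutes_inverses[OF \<sigma>] entry)
  also have "\<dots> = (\<Sum>f\<in>{..<n} \<rightarrow>\<^sub>E {..<t}. \<Prod>i<n. v (Hilbert_Choice.inv \<sigma> i) (f i) * v i (f i))"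
    by (rule prod_sum_PiE) auto
  also have "\<dots> = (\<Sum>f\<in>{..<n} \<rightarrow>\<^sub>E {..<t}. \<Prod>i<n. v i (f i) * v i (f (\<sigma> i)))"
  proof (intro sum.cong refl)
    fix f
    have "(\<Prod>i<n. v (Hilbert_Choice.inv \<sigma> i) (f i)) = (\<Prod>i<n. v i (f (\<sigma> i)))"
      using prod.permute[OF \<sigma>, of "\<lambda>i. v (Hilbert_Choice.inv \<sigma> i) (f i)"] by (simp add: o_def permutes_inverses[OF \<sigma>])
    then show "(\<Prod>i<n. v (Hilbert_Choice.inv \<sigma> i) (f i) * v i (f i)) = (\<Prod>i<n. v i (f i) * v i (f (\<sigma> i)))"
      by (simp add: prod.distrib mult.commute)
  qed
  finally show ?thesis .
qed

lemma indep_copies_second_moments: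
  assumes w: "w \<in> measurable P (real_space t)"
    and int: "\<And>k l. k < t \<Longrightarrow> l < t \<Longrightarrow> integrable P (\<lambda>x. w x k * w x l)"
    and Q: "prob_space Q"
    and W: "indep_copies t P w n Q W"
    and "i < n" "k < t" "l < t"
  shows "integrable Q (\<lambda>x. W i x k * W i x l)"
    and "(\<integral>x. W i x k * W i x l \<partial>Q) = moment_matrix t P w $$ (k, l)"
proof -
  let ?h = "\<lambda>y :: nat \<Rightarrow> real. y k * y l"
  have h: "?h \<in> borel_measurable (real_space t)"
    using \<open>k < t\<close> \<open>l < t\<close> by (auto intro!: borel_measurable_times measurable_component_singleton)
  have Wi: "W i \<in> measurable Q (real_space t)"
    using W Q \<open>i < n\<close> by (auto simp: indep_copies_def prob_space.indep_vars_def)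
  have distr: "distr Q (real_space t) (W i) = distr P (real_space t) w"
    using W \<open>i < n\<close> by (auto simp: indep_copies_def)
  show "integrable Q (\<lambda>x. W i x k * W i x l)"
    using integrable_distr_eq[OF Wi h] integrable_distr_eq[OF w h] int \<open>k < t\<close> \<open>l < t\<close> distr by simp
  show "(\<integral>x. W i x k * W i x l \<partial>Q) = moment_matrix t P w $$ (k, l)"
    using integral_distr[OF Wi h] integral_distr[OF w h] \<open>k < t\<close> \<open>l < t\<close> distr
    by (simp add: moment_matrix_def)
qed

text \<open>
  For fixed \<open>\<sigma>\<close> and \<open>f\<close>, the \<open>i\<close>-th factor of the monomial is a function of the column \<open>W i\<close> alone.
  So the factors are independent and integrable, and second moments suffice for the product to be integrable.
\<close>
lemma expectation_gram_permutation_sum: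
  fixes \<theta> :: "(nat \<Rightarrow> nat) \<Rightarrow> real"
  assumes w: "w \<in> measurable P (real_space t)"
    and int: "\<And>k l. k < t \<Longrightarrow> l < t \<Longrightarrow> integrable P (\<lambda>x. w x k * w x l)"
    and Q: "prob_space Q"
    and W: "indep_copies t P w n Q W"
  shows "(\<integral>x. (\<Sum>\<sigma> | \<sigma> permutes {..<n}. \<theta> \<sigma> * (\<Prod>i<n. gram_matrix t n (\<lambda>i. W i x) $$ (i, \<sigma> i))) \<partial>Q) =
    labelled_perm_sum t \<theta> (\<lambda>_. moment_matrix t P w) {..<n}"
proof -
  interpret prob_space Q by (rule Q)
  let ?X = "\<lambda>\<sigma> f i x. W i x (f i) * W i x (f (\<sigma> i))"
  have X: "integrable Q (\<lambda>x. \<Prod>i<n. ?X \<sigma> f i x)"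
    "(\<integral>x. (\<Prod>i<n. ?X \<sigma> f i x) \<partial>Q) = (\<Prod>i<n. moment_matrix t P w $$ (f i, f (\<sigma> i)))"
    if \<sigma>: "\<sigma> permutes {..<n}" and f: "f \<in> {..<n} \<rightarrow>\<^sub>E {..<t}" for \<sigma> f
  proof -
    have lt: "f i < t" "f (\<sigma> i) < t" if "i < n" for i
      using that f permutes_in_image[OF \<sigma>, of i] by auto
    have "indep_vars (\<lambda>_. real_space t) W {..<n}"
      using W by (simp add: indep_copies_def)
    then have indep: "indep_vars (\<lambda>_. borel) (?X \<sigma> f) {..<n}"
      by (rule indep_vars_compose2[where Y = "\<lambda>i y. y (f i) * y (f (\<sigma> i))"])
         (auto intro!: borel_measurable_times measurable_component_singleton lt)
    note moments = indep_copies_second_moments[OF w int Q W]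
    have integrable: "integrable Q (?X \<sigma> f i)" if "i \<in> {..<n}" for i
      using that lt by (intro moments) auto
    show "integrable Q (\<lambda>x. \<Prod>i<n. ?X \<sigma> f i x)"
      by (rule indep_vars_integrable[OF _ indep integrable]) auto
    have "(\<integral>x. (\<Prod>i<n. ?X \<sigma> f i x) \<partial>Q) = (\<Prod>i<n. \<integral>x. ?X \<sigma> f i x \<partial>Q)"
      by (rule indep_vars_lebesgue_integral[OF _ indep integrable]) auto
    then show "(\<integral>x. (\<Prod>i<n. ?X \<sigma> f i x) \<partial>Q) = (\<Prod>i<n. moment_matrix t P w $$ (f i, f (\<sigma> i)))"
      using lt by (simp add: moments)
  qed
  have "(\<integral>x. (\<Sum>\<sigma> | \<sigma> permutes {..<n}. \<theta> \<sigma> * (\<Prod>i<n. gram_matrix t n (\<lambda>i. W i x) $$ (i, \<sigma> i))) \<partial>Q) =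
    (\<integral>x. (\<Sum>\<sigma> | \<sigma> permutes {..<n}. \<theta> \<sigma> * (\<Sum>f\<in>{..<n} \<rightarrow>\<^sub>E {..<t}. \<Prod>i<n. ?X \<sigma> f i x)) \<partial>Q)"
    by (simp add: gram_matrix_permutation_product)
  also have "\<dots> = (\<Sum>\<sigma> | \<sigma> permutes {..<n}. \<theta> \<sigma> *
      (\<Sum>f\<in>{..<n} \<rightarrow>\<^sub>E {..<t}. \<integral>x. (\<Prod>i<n. ?X \<sigma> f i x) \<partial>Q))"
    by (subst Bochner_Integration.integral_sum)
       (auto intro!: sum.cong Bochner_Integration.integral_sum integrable_mult_right
          Bochner_Integration.integrable_sum X(1))
  also have "\<dots> = labelled_perm_sum t \<theta> (\<lambda>_. moment_matrix t P w) {..<n}"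
    unfolding labelled_perm_sum_def by (simp add: X(2))
  finally show ?thesis .
qed

theorem corollary2:
  fixes t :: nat
    and P :: "'b measure" and w :: "'b \<Rightarrow> nat \<Rightarrow> real"
    and Q :: "nat \<Rightarrow> 'c measure" and W :: "nat \<Rightarrow> nat \<Rightarrow> 'c \<Rightarrow> nat \<Rightarrow> real"
    and a p tr :: "nat \<Rightarrow> real"
  assumes "t \<ge> 1"
    and "prob_space P"
    and "w \<in> measurable P (real_space t)"
    and "\<And>i j. i < t \<Longrightarrow> j < t \<Longrightarrow> integrable P (\<lambda>x. w x i * w x j)"
    and "\<And>n. prob_space (Q n)"
    and "\<And>n. indep_copies t P w n (Q n) (W n)"
    and "\<And>n. a n = (\<integral>x. Determinant.det (gram_matrix t n (\<lambda>i. W n i x)) \<partial>Q n)"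
    and "\<And>n. p n = (\<integral>x. perm (gram_matrix t n (\<lambda>i. W n i x)) \<partial>Q n)"
    and "\<And>n. tr n = mat_trace (moment_matrix t P w ^\<^sub>m n)"
  shows "a 0 = 1 \<and> p 0 = 1 \<and>
    (\<forall>n. a (n + 1) = (\<Sum>j = 0..n. real (n choose j) * (-1) ^ j * fact j * a (n - j) * tr (j + 1))) \<and>
    (\<forall>n. p (n + 1) = (\<Sum>j = 0..n. real (n choose j) * fact j * p (n - j) * tr (j + 1)))"
proof -
  let ?M = "moment_matrix t P w"
  have M: "?M \<in> carrier_mat t t" by (simp add: moment_matrix_def)
  have dim: "dim_row (gram_matrix t n v) = n" "dim_col (gram_matrix t n v) = n" for n v
    by (simp_all add: gram_matrix_def Let_def)
  note expectation = expectation_gram_permutation_sum[OF assms(3,4,5,6)]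
  have a: "a n = labelled_perm_sum t (\<lambda>\<sigma>. of_int (sign \<sigma>)) (\<lambda>_. ?M) {..<n}" for n
    using expectation[of n "\<lambda>\<sigma>. of_int (sign \<sigma>)"]
    by (simp add: assms(7) Determinant.det_def dim atLeast0LessThan)
  have p: "p n = labelled_perm_sum t (\<lambda>_. 1) (\<lambda>_. ?M) {..<n}" for n
    using expectation[of n "\<lambda>_. 1"] by (simp add: assms(8) perm_def dim atLeast0LessThan)
  have "a 0 = 1" "p 0 = 1"
    unfolding a p by (simp_all add: labelled_perm_sum_def)
  moreover have "a (n + 1) =
      (\<Sum>j = 0..n. real (n choose j) * (-1) ^ j * fact j * a (n - j) * tr (j + 1))" for n
    using labelled_perm_sum_recursion[OF M transposition_multiplier_sign, of n]
    by (simp only: a assms(9) Suc_eq_plus1 of_nat_fact)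
  moreover have "p (n + 1) = (\<Sum>j = 0..n. real (n choose j) * fact j * p (n - j) * tr (j + 1))" for n
    using labelled_perm_sum_recursion[OF M transposition_multiplier_trivial, of n]
    by (simp only: p assms(9) Suc_eq_plus1 of_nat_fact power_one mult_1_right)
  ultimately show ?thesis by blast
qed

end
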